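(* Let $\tau_0=a_0+b_0i\in\mathcal{F}$ with $a_0,b_0\in K$ for some subfield $K\subseteq\mathbb{R}$. There exists a finite sequence of numbers $\tau_1,\dots,\tau_n$, $\tau_k=a_k+b_ki$, such that for all $1\le k\le n$ $$a_k=\frac12,\qquad b_k=\frac{a_{k-1}^2+b_{k-1}^2-a_{k-1}}{2b_{k-1}}\in K,$$ with $\Lambda_{\tau_k}=H(\Lambda_{\tau_{k-1}})$ for all $1\le k\le n$, and $\Lambda_{\tau_n}$ well-rounded, hence $H(\Lambda_{\tau_n})$ is similar to $\Lambda_{\tau_n}$. Furthermore, $\tau_1,\dots,\tau_{n-1}\in\mathcal{F}$, $|\tau_n|\le 1$, and $n\le\log_2\!\left(\frac{2b_0}{\sqrt3}\right)$.
   Context: $\mathcal{F}=\{\tau=a+bi\in\mathbb{C}: b\ge 0,\ 0\le a\le 1/2,\ |\tau|\ge1\}$. For $\tau=a+bi$, $\Lambda_\tau=\begin{pmatrix}1&a\\0&b\end{pmatrix}\mathbb{Z}^2\subset\mathbb{R}^2$. For a lattice $L\subset\mathbb{R}^2$ with successive minima $\lambda_1\le\lambda_2$, let $\boldsymbol{x}_1,\boldsymbol{x}_2$ be minimal basis vectors ($\|\boldsymbol{x}_i\|=\lambda_i$) with angle between them in $[\pi/3,\pi/2]$. A deep hole of $L$ is a point of $\mathbb{R}^2$ at maximal distance from $L$; the fundamental deep hole $\boldsymbol{z}$ is the unique deep hole in the triangle with vertices $\boldsymbol{0},\boldsymbol{x}_1,\boldsymbol{x}_2$, and the deep hole lattice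 is $H(L)=\operatorname{span}_{\mathbb{Z}}\{\boldsymbol{x}_1,\boldsymbol{z}\}$. $L$ is well-rounded if $\lambda_1=\lambda_2$. Lattices $L_1,L_2$ are similar if $L_2=cUL_1$ with $c>0$, $U\in O_2(\mathbb{R})$.
   Formalization: The bound on n is proved as n ≤ ⌈log_2(2b_0/√3)⌉; without rounding up it fails, e.g. for τ_0 = (6/5)i, where it would force n = 0 although |τ_0| > 1 and Λ_{τ_0} is not well-rounded. *)

theory Defs
  imports "HOL-Analysis.Analysis"
begin

definition real_subfield :: "real set \<Rightarrow> bool" where
  "real_subfield K \<longleftrightarrow>
     0 \<in> K \<and> 1 \<in> K \<and>
     (\<forall>x\<in>K. \<forall>y\<in>K. x + y \<in> K \<and> x * y \<in> K) \<and>
     (\<forall>x\<in>K. - x \<in> K \<and> inverse x \<in> K)"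

definition fund_dom :: "complex set" where
  "fund_dom = {\<tau>. 0 \<le> Im \<tau> \<and> 0 \<le> Re \<tau> \<and> Re \<tau> \<le> 1 / 2 \<and> 1 \<le> cmod \<tau>}"

definition Lat :: "complex \<Rightarrow> (real^2) set" where
  "Lat \<tau> = (\<lambda>v. (vector [vector [1, Re \<tau>], vector [0, Im \<tau>]] :: real^2^2) *v v) ` {v. \<forall>i. v $ i \<in> \<int>}"

definition int_span :: "real^2 \<Rightarrow> real^2 \<Rightarrow> (real^2) set" where
  "int_span x y = {of_int m *\<^sub>R x + of_int n *\<^sub>R y | m n. True}"

definition lattice_basis :: "(real^2) set \<Rightarrow> real^2 \<Rightarrow> real^2 \<Rightarrow> bool" where
  "lattice_basis L x y \<longleftrightarrow> x \<noteq> y \<and> independent {x, y} \<and> L = int_span x y"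

definition succ_min :: "nat \<Rightarrow> (real^2) set \<Rightarrow> real" where
  "succ_min i L = Inf {r. 0 \<le> r \<and> i \<le> dim (L \<inter> cball 0 r)}"

definition well_rounded :: "(real^2) set \<Rightarrow> bool" where
  "well_rounded L \<longleftrightarrow> (\<exists>x y. lattice_basis L x y) \<and> succ_min 1 L = succ_min 2 L"

definition vec_angle :: "real^2 \<Rightarrow> real^2 \<Rightarrow> real" where
  "vec_angle x y = arccos (x \<bullet> y / (norm x * norm y))"

definition minimal_basis :: "(real^2) set \<Rightarrow> real^2 \<Rightarrow> real^2 \<Rightarrow> bool" where
  "minimal_basis L x1 x2 \<longleftrightarrow>
     lattice_basis L x1 x2 \<and> norm x1 = succ_min 1 L \<and> norm x2 = succ_min 2 L \<and>
     vec_angle x1 x2 \<in> {pi / 3..pi / 2}"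

definition deep_hole :: "(real^2) set \<Rightarrow> real^2 \<Rightarrow> bool" where
  "deep_hole L z \<longleftrightarrow> (\<forall>y. infdist y L \<le> infdist z L)"

text \<open>The minimal basis is not unique, and when \<open>L\<close> is well-rounded different choices can give
  different (though similar) lattices \<open>H(L)\<close>.  Hence \<open>H(L)\<close> is rendered as a relation:
  \<open>deep_hole_lattice L M\<close> says that \<open>M\<close> is \<open>H(L)\<close> for some admissible choice of the minimal basis.
  That \<open>H(L)\<close> is well defined and equal to \<open>M\<^sub>0\<close> is expressed by
  \<open>\<forall>M. deep_hole_lattice L M \<longleftrightarrow> M = M\<^sub>0\<close>.\<close>

definition deep_hole_lattice :: "(real^2) set \<Rightarrow> (real^2) set \<Rightarrow> bool" where
  "deep_hole_lattice L M \<longleftrightarrow>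
     (\<exists>x1 x2 z. minimal_basis L x1 x2 \<and> deep_hole L z \<and> z \<in> convex hull {0, x1, x2} \<and>
        M = int_span x1 z)"

definition similar_lattices :: "(real^2) set \<Rightarrow> (real^2) set \<Rightarrow> bool" where
  "similar_lattices L1 L2 \<longleftrightarrow>
     (\<exists>(c::real) (U::real^2^2). 0 < c \<and> orthogonal_matrix U \<and> L2 = (\<lambda>x. c *\<^sub>R (U *v x)) ` L1)"

end

theory Submission
  imports Defs
begin

text \<open>The minimal bases of a lattice are exactly its reduced bases, those with
  \<open>0 \<le> 2 x \<bullet> y \<le> x \<bullet> x \<le> y \<bullet> y\<close>.  The triangle spanned by such a basis is not obtuse, and the only deep
  hole in it is its circumcenter, so that \<open>H\<close> sends \<open>\<Lambda>\<^sub>\<tau>\<close> with \<open>\<bar>\<tau>\<bar> > 1\<close> to the lattice of the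
  circumcenter of \<open>0, 1, \<tau>\<close>.  This at least halves the imaginary part but leaves it at least \<open>\<surd>3 / 6\<close>.
  After finitely many steps \<open>\<bar>\<tau>\<bar> \<le> 1\<close>, and then \<open>\<tau>\<close> and one of \<open>1 - \<tau>\<close>, \<open>\<tau> - 1\<close> (or \<open>1\<close> and \<open>\<tau>\<close>, if
  no step was needed) form a reduced basis of equal norms.\<close>

section \<open>Linear algebra in the plane\<close>

definition reduced_pair :: "real^2 \<Rightarrow> real^2 \<Rightarrow> bool" where
  "reduced_pair x y \<longleftrightarrow> 0 \<le> x \<bullet> y \<and> 2 * (x \<bullet> y) \<le> x \<bullet> x \<and> x \<bullet> x \<le> y \<bullet> y"

text \<open>These are the conditions \<open>norm (c - x) = norm c\<close> and
  \<open>norm (c - y) = norm c\<close>, squared and expanded, which makes them linear in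
  \<open>c\<close>.\<close>

definition circumcenter :: "real^2 \<Rightarrow> real^2 \<Rightarrow> real^2 \<Rightarrow> bool" where
  "circumcenter x y c \<longleftrightarrow> 2 * (c \<bullet> x) = x \<bullet> x \<and> 2 * (c \<bullet> y) = y \<bullet> y"

lemma inner_real2: "(x::real^2) \<bullet> y = x $ 1 * y $ 1 + x $ 2 * y $ 2"
  by (simp add: inner_vec_def sum_2)

lemma vec_eq_real2: "(x::real^2) = y \<longleftrightarrow> x $ 1 = y $ 1 \<and> x $ 2 = y $ 2"
  by (simp add: vec_eq_iff forall_2)

text \<open>Lagrange's identity. It turns a nonzero determinant into a positive Gram
  determinant.\<close>

lemma gram_eq_det_sq:
  fixes x y :: "real^2"
  shows "(x \<bullet> x) * (y \<bullet> y) - (x \<bullet> y)\<^sup>2 = (x $ 1 * y $ 2 - x $ 2 * y $ 1)\<^sup>2"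
  unfolding inner_real2 by algebra

text \<open>The conjunct \<open>x \<noteq> y\<close> rules out the collapse of \<open>{x, y}\<close>
  to a singleton, which would be independent for nonzero \<open>x\<close>.\<close>

lemma independent_iff_det:
  fixes x y :: "real^2"
  shows "x \<noteq> y \<and> independent {x, y} \<longleftrightarrow> x $ 1 * y $ 2 - x $ 2 * y $ 1 \<noteq> 0"
proof -
  have "dependent {x, y} \<or> x = y \<longleftrightarrow> x $ 1 * y $ 2 - x $ 2 * y $ 1 = 0"
  proof (cases "x = y \<or> y = 0")
    case True
    then show ?thesis
      using dependent_zero[of "{x, y}"] by auto
  next
    case False
    have "dependent {x, y} \<longleftrightarrow> (\<exists>k. x = k *\<^sub>R y)"
      using False independent_insert[of x "{y}"] by (auto simp: span_singleton)
    also have "\<dots> \<longleftrightarrow> x $ 1 * y $ 2 - x $ 2 * y $ 1 = 0"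
    proof
      assume "\<exists>k. x = k *\<^sub>R y"
      then show "x $ 1 * y $ 2 - x $ 2 * y $ 1 = 0" by auto
    next
      assume d: "x $ 1 * y $ 2 - x $ 2 * y $ 1 = 0"
      show "\<exists>k. x = k *\<^sub>R y"
      proof (cases "y $ 1 = 0")
        case True
        then have "y $ 2 \<noteq> 0" using False by (auto simp: vec_eq_real2)
        then show ?thesis using d True
          by (intro exI[of _ "x $ 2 / y $ 2"]) (auto simp: vec_eq_real2 field_simps)
      next
        case y1: False
        then show ?thesis using d
          by (intro exI[of _ "x $ 1 / y $ 1"]) (auto simp: vec_eq_real2 field_simps)
      qed
    qed
    finally show ?thesis using False by simp
  qed
  then show ?thesis by blast
qed

lemma lattice_basis_iff:
  "lattice_basis L x y \<longleftrightarrow> x $ 1 * y $ 2 - x $ 2 * y $ 1 \<noteq> 0 \<and> L = int_span x y"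
  unfolding lattice_basis_def using independent_iff_det[of x y] by blast

lemma coordinates_exist:
  fixes x y p :: "real^2"
  assumes "x $ 1 * y $ 2 - x $ 2 * y $ 1 \<noteq> 0"
  obtains u v where "p = u *\<^sub>R x + v *\<^sub>R y"
proof -
  define d where "d = x $ 1 * y $ 2 - x $ 2 * y $ 1"
  have d: "d \<noteq> 0" using assms by (simp add: d_def)
  \<comment> \<open>The coefficients come from Cramer's rule.\<close>
  have "p = ((p $ 1 * y $ 2 - p $ 2 * y $ 1) / d) *\<^sub>R x + ((x $ 1 * p $ 2 - x $ 2 * p $ 1) / d) *\<^sub>R y"
    using d by (simp add: vec_eq_real2 add_divide_distrib[symmetric] nonzero_eq_divide_eq)
      (simp add: d_def algebra_simps)
  then show thesis by (rule that)
qed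

lemma in_int_span_basis:
  "x \<in> int_span x y" "y \<in> int_span x y" "0 \<in> int_span x y"
proof -
  have "x = of_int 1 *\<^sub>R x + of_int 0 *\<^sub>R y" "y = of_int 0 *\<^sub>R x + of_int 1 *\<^sub>R y"
    "0 = of_int 0 *\<^sub>R x + of_int 0 *\<^sub>R y" by simp_all
  then show "x \<in> int_span x y" "y \<in> int_span x y" "0 \<in> int_span x y"
    unfolding int_span_def by blast+
qed

section \<open>Short vectors and successive minima\<close>

lemma norm_comb_sq:
  fixes x y :: "real^2"
  shows "(norm (m *\<^sub>R x + n *\<^sub>R y))\<^sup>2 = m\<^sup>2 * (x \<bullet> x) + 2 * (m * n) * (x \<bullet> y) + n\<^sup>2 * (y \<bullet> y)"
  by (simp add: power2_norm_eq_inner inner_real2) algebra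

text \<open>Twice the form is a sum of three squares, so it is positive, and a positive integer is
  at least 1.\<close>

lemma int_quadratic_ge_one:
  fixes m n :: int
  assumes "m \<noteq> 0 \<or> n \<noteq> 0"
  shows "1 \<le> m\<^sup>2 - \<bar>m * n\<bar> + n\<^sup>2"
proof -
  have "0 \<le> (\<bar>m\<bar> - \<bar>n\<bar>)\<^sup>2 + \<bar>m\<bar>\<^sup>2 + \<bar>n\<bar>\<^sup>2" by simp
  moreover have "\<bar>m\<bar>\<^sup>2 + \<bar>n\<bar>\<^sup>2 > 0" using assms by (simp add: sum_power2_gt_zero_iff)
  moreover have "(\<bar>m\<bar> - \<bar>n\<bar>)\<^sup>2 + \<bar>m\<bar>\<^sup>2 + \<bar>n\<bar>\<^sup>2 = 2 * (m\<^sup>2 - \<bar>m * n\<bar> + n\<^sup>2)"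
    by (simp add: power2_diff abs_mult)
  ultimately show ?thesis by (smt (verit) zero_le_power2)
qed

text \<open>In the squared norm, \<open>2 * (x \<bullet> y)\<close> is at worst
  \<open>x \<bullet> x\<close> with the sign of \<open>m * n\<close> against it, and the part of
  \<open>y \<bullet> y\<close> beyond one copy may be lowered to \<open>x \<bullet> x\<close>. The
  surplus over \<open>y \<bullet> y\<close> is then at least \<open>(m\<^sup>2 - \<bar>m * n\<bar> +
  n\<^sup>2 - 1) * (x \<bullet> x)\<close>.\<close>

lemma reduced_norm_ge_snd:
  fixes m n :: int
  assumes "reduced_pair x y" "n \<noteq> 0"
  shows "norm y \<le> norm (of_int m *\<^sub>R x + of_int n *\<^sub>R y)"
proof -
  let ?A = "x \<bullet> x" and ?B = "y \<bullet> y" and ?C = "x \<bullet> y"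
  have red: "0 \<le> ?C" "2 * ?C \<le> ?A" "?A \<le> ?B" using assms(1) by (auto simp: reduced_pair_def)
  have i: "1 \<le> m\<^sup>2 - \<bar>m * n\<bar> + n\<^sup>2" using int_quadratic_ge_one assms(2) by blast
  then have "1 \<le> real_of_int (m\<^sup>2 - \<bar>m * n\<bar> + n\<^sup>2)" by (simp only: of_int_1_le_iff)
  then have q: "1 \<le> (of_int m)\<^sup>2 - \<bar>of_int m * of_int n\<bar> + (of_int n :: real)\<^sup>2" by (simp add: abs_mult)
  have "1 \<le> n\<^sup>2" using assms(2) by (smt (verit) zero_less_power2)
  then have n: "1 \<le> (of_int n :: real)\<^sup>2" by (metis of_int_1_le_iff of_int_power)
  have "\<bar>of_int m * of_int n\<bar> * (2 * ?C) \<le> \<bar>of_int m * of_int n\<bar> * ?A"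
    using red by (intro mult_left_mono) auto
  moreover have "- (2 * (of_int m * of_int n) * ?C) \<le> \<bar>of_int m * of_int n\<bar> * (2 * ?C)"
    using red mult_right_mono[of "- (of_int m * of_int n)" "\<bar>of_int m * of_int n\<bar>" "2 * ?C"] by simp
  moreover have "((of_int n)\<^sup>2 - 1) * ?A \<le> ((of_int n)\<^sup>2 - 1) * ?B"
    using red n by (intro mult_left_mono) auto
  moreover have "0 \<le> ((of_int m)\<^sup>2 - \<bar>of_int m * of_int n\<bar> + (of_int n :: real)\<^sup>2 - 1) * ?A"
    using q by (intro mult_nonneg_nonneg) auto
  ultimately have "?B \<le> (of_int m)\<^sup>2 * ?A + 2 * (of_int m * of_int n) * ?C + (of_int n)\<^sup>2 * ?B"
    by (simp add: algebra_simps)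
  then have "(norm y)\<^sup>2 \<le> (norm (of_int m *\<^sub>R x + of_int n *\<^sub>R y))\<^sup>2"
    by (simp only: norm_comb_sq) (simp add: power2_norm_eq_inner)
  then show ?thesis by (rule power2_le_imp_le) simp
qed

lemma reduced_norm_le: "reduced_pair x y \<Longrightarrow> norm x \<le> norm y"
  by (simp add: reduced_pair_def norm_le)

lemma reduced_norm_ge_fst:
  fixes m n :: int
  assumes "reduced_pair x y" "m \<noteq> 0 \<or> n \<noteq> 0"
  shows "norm x \<le> norm (of_int m *\<^sub>R x + of_int n *\<^sub>R y)"
proof (cases "n = 0")
  case True
  then have "1 \<le> \<bar>real_of_int m\<bar>" using assms by simp
  then show ?thesis using True mult_right_mono[of 1 "\<bar>real_of_int m\<bar>" "norm x"] by simp
next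
  case False
  then show ?thesis using reduced_norm_ge_snd[OF assms(1), of n m] reduced_norm_le[OF assms(1)] by simp
qed

text \<open>Both infima are taken over closed rays. For the second one, dimension two forces a
  lattice vector off the line of \<open>x\<close>, hence one with a nonzero coefficient of
  \<open>y\<close>.\<close>

lemma succ_min_reduced:
  assumes "lattice_basis L x y" "reduced_pair x y"
  shows "succ_min 1 L = norm x" "succ_min 2 L = norm y"
proof -
  have L: "L = int_span x y" and ind: "independent {x, y}" and ne: "x \<noteq> y"
    using assms(1) by (auto simp: lattice_basis_def)
  have x0: "x \<noteq> 0" using dependent_zero[of "{x, y}"] ind by blast
  have "{r. 0 \<le> r \<and> 1 \<le> dim (L \<inter> cball 0 r)} = {norm x..}"
  proof (intro equalityI subsetI)
    fix r assume "r \<in> {r. 0 \<le> r \<and> 1 \<le> dim (L \<inter> cball 0 r)}"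
    then have "\<not> L \<inter> cball 0 r \<subseteq> {0}" by (metis (mono_tags, lifting) dim_eq_0 mem_Collect_eq not_one_le_zero)
    then obtain v where v: "v \<in> L" "norm v \<le> r" "v \<noteq> 0" by (auto simp: subset_iff)
    then obtain m n where mn: "v = of_int m *\<^sub>R x + of_int n *\<^sub>R y" unfolding L int_span_def by auto
    then have "m \<noteq> 0 \<or> n \<noteq> 0" using v(3) by auto
    then have "norm x \<le> norm v" using reduced_norm_ge_fst[OF assms(2)] mn by blast
    then show "r \<in> {norm x..}" using v(2) by simp
  next
    fix r assume r: "r \<in> {norm x..}"
    then have "x \<in> L \<inter> cball 0 r" using in_int_span_basis L by auto
    then have "\<not> L \<inter> cball 0 r \<subseteq> {0}" using x0 by auto
    then have "dim (L \<inter> cball 0 r) \<noteq> 0" by (simp only: dim_eq_0 not_False_eq_True)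
    then have "1 \<le> dim (L \<inter> cball 0 r)" by linarith
    moreover have "0 \<le> r" using r norm_ge_zero[of x] by (simp del: norm_ge_zero)
    ultimately show "r \<in> {r. 0 \<le> r \<and> 1 \<le> dim (L \<inter> cball 0 r)}" by simp
  qed
  then show "succ_min 1 L = norm x" by (simp add: succ_min_def)
  have "{r. 0 \<le> r \<and> 2 \<le> dim (L \<inter> cball 0 r)} = {norm y..}"
  proof (intro equalityI subsetI)
    fix r assume r: "r \<in> {r. 0 \<le> r \<and> 2 \<le> dim (L \<inter> cball 0 r)}"
    have "dim (L \<inter> cball 0 r) \<le> 1" if "L \<inter> cball 0 r \<subseteq> span {x}"
      using dim_le_card[OF that] by simp
    then obtain v where v: "v \<in> L" "norm v \<le> r" "v \<notin> span {x}" using r by force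
    then obtain m n where mn: "v = of_int m *\<^sub>R x + of_int n *\<^sub>R y" unfolding L int_span_def by auto
    then have "n \<noteq> 0" using v(3) by (auto simp: span_singleton)
    then have "norm y \<le> norm v" using reduced_norm_ge_snd[OF assms(2)] mn by blast
    then show "r \<in> {norm y..}" using v(2) by simp
  next
    fix r assume r: "r \<in> {norm y..}"
    then have "{x, y} \<subseteq> L \<inter> cball 0 r" using in_int_span_basis L reduced_norm_le[OF assms(2)] by auto
    then have "card {x, y} \<le> dim (L \<inter> cball 0 r)" using ind independent_card_le_dim by blast
    then show "r \<in> {r. 0 \<le> r \<and> 2 \<le> dim (L \<inter> cball 0 r)}"
      using r ne norm_ge_zero[of y] by (simp del: norm_ge_zero)
  qed
  then show "succ_min 2 L = norm y" by (simp add: succ_min_def)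
qed

section \<open>Minimal bases are reduced bases\<close>

lemma lattice_basis_nonzero:
  assumes "lattice_basis L x y"
  shows "x \<noteq> 0" "y \<noteq> 0"
  using assms by (auto simp: lattice_basis_iff)

text \<open>Since \<open>arccos\<close> is decreasing on [-1, 1], the window says that the cosine
  lies between 0 and 1/2; the denominator is then cleared.\<close>

lemma vec_angle_iff:
  assumes "x \<noteq> 0" "y \<noteq> 0"
  shows "vec_angle x y \<in> {pi / 3..pi / 2} \<longleftrightarrow> 0 \<le> x \<bullet> y \<and> 2 * (x \<bullet> y) \<le> norm x * norm y"
proof -
  let ?t = "x \<bullet> y / (norm x * norm y)"
  have p: "0 < norm x * norm y" using assms by simp
  have "\<bar>?t\<bar> \<le> 1" using p Cauchy_Schwarz_ineq2[of x y] by (simp add: abs_mult)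
  then have t: "-1 \<le> ?t" "?t \<le> 1" by linarith+
  have "arccos (1 / 2) = pi / 3" using arccos_cos[of "pi / 3"] by (simp add: cos_60)
  then have "pi / 3 \<le> arccos ?t \<longleftrightarrow> arccos (1 / 2) \<le> arccos ?t" by (simp only:)
  also have "\<dots> \<longleftrightarrow> ?t \<le> 1 / 2" using t by (subst arccos_le_mono) auto
  finally have 1: "pi / 3 \<le> arccos ?t \<longleftrightarrow> 2 * (x \<bullet> y) \<le> norm x * norm y"
    using p by (simp add: field_simps)
  have "arccos ?t \<le> pi / 2 \<longleftrightarrow> arccos ?t \<le> arccos 0" by simp
  also have "\<dots> \<longleftrightarrow> 0 \<le> ?t" using t by (subst arccos_le_mono) auto
  finally have 2: "arccos ?t \<le> pi / 2 \<longleftrightarrow> 0 \<le> x \<bullet> y"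
    using p by (simp add: zero_le_divide_iff)
  show ?thesis unfolding vec_angle_def using 1 2 by auto
qed

text \<open>The reduced basis \<open>e1\<close>, \<open>e2\<close> provides the values of the
  successive minima. The angle yields only \<open>2 * (x \<bullet> y) \<le> norm x * norm y\<close>,
  which is too weak when the norms differ; comparing \<open>y\<close> with \<open>y - x\<close>
  closes the gap.\<close>

lemma minimal_basis_iff:
  assumes "lattice_basis L e1 e2" "reduced_pair e1 e2"
  shows "minimal_basis L x y \<longleftrightarrow> lattice_basis L x y \<and> reduced_pair x y"
proof
  assume "lattice_basis L x y \<and> reduced_pair x y"
  then have lb: "lattice_basis L x y" and red: "reduced_pair x y" by auto
  note nz = lattice_basis_nonzero[OF lb]
  have "norm x * norm x \<le> norm x * norm y" using reduced_norm_le[OF red] by (simp add: mult_left_mono)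
  then have "vec_angle x y \<in> {pi / 3..pi / 2}"
    using red vec_angle_iff[OF nz] by (auto simp: reduced_pair_def dot_square_norm power2_eq_square)
  then show "minimal_basis L x y" using lb succ_min_reduced[OF lb red] by (simp add: minimal_basis_def)
next
  assume mb: "minimal_basis L x y"
  then have lb: "lattice_basis L x y" by (simp add: minimal_basis_def)
  note nz = lattice_basis_nonzero[OF lb]
  have n: "norm x = norm e1" "norm y = norm e2" using mb succ_min_reduced[OF assms] by (auto simp: minimal_basis_def)
  have ang: "0 \<le> x \<bullet> y" "2 * (x \<bullet> y) \<le> norm x * norm y"
    using mb vec_angle_iff[OF nz] by (auto simp: minimal_basis_def)
  have le: "norm x \<le> norm y" using n reduced_norm_le[OF assms(2)] by simp
  have "2 * (x \<bullet> y) \<le> x \<bullet> x"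
  proof (cases "norm x = norm y")
    case True
    then show ?thesis using ang(2) by (simp add: dot_square_norm power2_eq_square)
  next
    case False
    have L: "L = int_span e1 e2" "L = int_span x y" using assms(1) lb by (auto simp: lattice_basis_def)
    have "x \<in> int_span e1 e2" "y \<in> int_span e1 e2" using in_int_span_basis L by auto
    then obtain m n p q where mn: "x = of_int m *\<^sub>R e1 + of_int n *\<^sub>R e2"
      and pq: "y = of_int p *\<^sub>R e1 + of_int q *\<^sub>R e2"
      unfolding int_span_def by blast
    \<comment> \<open>Being strictly shorter than \<open>e2\<close>, the vector \<open>x\<close> is
      a multiple of \<open>e1\<close>. So \<open>y - x\<close> keeps the nonzero coefficient of
      \<open>e2\<close> in \<open>y\<close> and cannot be shorter than \<open>e2\<close>, whose norm
      is that of \<open>y\<close>.\<close>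
    have n0: "n = 0" using reduced_norm_ge_snd[OF assms(2), of n m] mn n False le by fastforce
    have "q \<noteq> 0"
    proof
      assume "q = 0"
      then have "x $ 1 * y $ 2 - x $ 2 * y $ 1 = 0" using mn pq n0 by simp
      then show False using lb by (simp add: lattice_basis_iff)
    qed
    moreover have "y - x = of_int (p - m) *\<^sub>R e1 + of_int q *\<^sub>R e2"
      using mn pq n0 by (simp add: algebra_simps)
    ultimately have "norm y \<le> norm (y - x)"
      using reduced_norm_ge_snd[OF assms(2), of q "p - m"] n by simp
    then have "y \<bullet> y \<le> (y - x) \<bullet> (y - x)" by (simp add: norm_le)
    then show ?thesis by (simp add: inner_simps inner_commute)
  qed
  then show "lattice_basis L x y \<and> reduced_pair x y" using lb ang le by (simp add: reduced_pair_def norm_le)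
qed

section \<open>Circumcenters and deep holes\<close>

lemma circumcenter_exists:
  assumes "x $ 1 * y $ 2 - x $ 2 * y $ 1 \<noteq> 0"
  obtains c where "circumcenter x y c"
proof -
  define d where "d = x $ 1 * y $ 2 - x $ 2 * y $ 1"
  define A B where "A = x \<bullet> x" and "B = y \<bullet> y"
  \<comment> \<open>Cramer's rule for the two linear equations of the circumcenter.\<close>
  define c :: "real^2" where
    "c = vector [(A * y $ 2 - B * x $ 2) / (2 * d), (B * x $ 1 - A * y $ 1) / (2 * d)]"
  have d: "d \<noteq> 0" using assms by (simp add: d_def)
  have "2 * (c \<bullet> x) = ((A * y $ 2 - B * x $ 2) * x $ 1 + (B * x $ 1 - A * y $ 1) * x $ 2) / d"
    by (simp add: inner_real2 c_def add_divide_distrib)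
  also have "(A * y $ 2 - B * x $ 2) * x $ 1 + (B * x $ 1 - A * y $ 1) * x $ 2 = A * d"
    by (simp add: d_def algebra_simps)
  finally have x: "2 * (c \<bullet> x) = A" using d by simp
  have "2 * (c \<bullet> y) = ((A * y $ 2 - B * x $ 2) * y $ 1 + (B * x $ 1 - A * y $ 1) * y $ 2) / d"
    by (simp add: inner_real2 c_def add_divide_distrib)
  also have "(A * y $ 2 - B * x $ 2) * y $ 1 + (B * x $ 1 - A * y $ 1) * y $ 2 = B * d"
    by (simp add: d_def algebra_simps)
  finally have "2 * (c \<bullet> y) = B" using d by simp
  then show thesis using x that by (simp add: circumcenter_def A_def B_def)
qed

lemma mem_triangle_iff:
  fixes x y p :: "'a::real_vector"
  shows "p \<in> convex hull {0, x, y} \<longleftrightarrow> (\<exists>u v. 0 \<le> u \<and> 0 \<le> v \<and> u + v \<le> 1 \<and> p = u *\<^sub>R x + v *\<^sub>R y)"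
proof
  assume "p \<in> convex hull {0, x, y}"
  then obtain w u v where "0 \<le> w" "0 \<le> u" "0 \<le> v" "w + u + v = 1" "p = w *\<^sub>R 0 + u *\<^sub>R x + v *\<^sub>R y"
    unfolding convex_hull_3 by blast
  then show "\<exists>u v. 0 \<le> u \<and> 0 \<le> v \<and> u + v \<le> 1 \<and> p = u *\<^sub>R x + v *\<^sub>R y"
    by (intro exI[of _ u] exI[of _ v]) simp
next
  assume "\<exists>u v. 0 \<le> u \<and> 0 \<le> v \<and> u + v \<le> 1 \<and> p = u *\<^sub>R x + v *\<^sub>R y"
  then obtain u v where uv: "0 \<le> u" "0 \<le> v" "u + v \<le> 1" "p = u *\<^sub>R x + v *\<^sub>R y" by blast
  have "0 \<le> 1 - u - v" "(1 - u - v) + u + v = 1" "p = (1 - u - v) *\<^sub>R 0 + u *\<^sub>R x + v *\<^sub>R y"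
    using uv by simp_all
  then show "p \<in> convex hull {0, x, y}" unfolding convex_hull_3 using uv by blast
qed

text \<open>Up to the positive factor \<open>2 * (A * B - C\<^sup>2)\<close>, the barycentric
  coordinates of \<open>c\<close> are \<open>B * (A - C)\<close>, \<open>A * (B - C)\<close> and
  \<open>C * (A + B - 2 * C)\<close>. They are nonnegative because no angle of the triangle is
  obtuse.\<close>

lemma circumcenter_in_triangle:
  assumes det: "x $ 1 * y $ 2 - x $ 2 * y $ 1 \<noteq> 0" and "reduced_pair x y" "circumcenter x y c"
  shows "c \<in> convex hull {0, x, y}"
proof -
  define A B C where "A = x \<bullet> x" and "B = y \<bullet> y" and "C = x \<bullet> y"
  have red: "0 \<le> C" "2 * C \<le> A" "A \<le> B" using assms(2) by (auto simp: reduced_pair_def A_def B_def C_def)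
  have D: "0 < A * B - C\<^sup>2" using gram_eq_det_sq[of x y] det by (simp add: A_def B_def C_def)
  obtain s t where c: "c = s *\<^sub>R x + t *\<^sub>R y" using coordinates_exist[OF det] .
  have e: "2 * (s * A + t * C) = A" "2 * (s * C + t * B) = B"
    using assms(3) by (simp_all add: c circumcenter_def A_def B_def C_def inner_simps inner_commute)
  have "(2 * s) * (A * B - C\<^sup>2) = B * (2 * (s * A + t * C)) - C * (2 * (s * C + t * B))"
    "(2 * t) * (A * B - C\<^sup>2) = A * (2 * (s * C + t * B)) - C * (2 * (s * A + t * C))"
    by (simp_all add: power2_eq_square algebra_simps)
  then have st: "(2 * s) * (A * B - C\<^sup>2) = B * (A - C)" "(2 * t) * (A * B - C\<^sup>2) = A * (B - C)"
    unfolding e by (simp_all add: algebra_simps)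
  moreover have "(2 * (1 - s - t)) * (A * B - C\<^sup>2)
      = 2 * (A * B - C\<^sup>2) - (2 * s) * (A * B - C\<^sup>2) - (2 * t) * (A * B - C\<^sup>2)"
    by (simp add: algebra_simps)
  then have "(2 * (1 - s - t)) * (A * B - C\<^sup>2) = C * ((A - C) + (B - C))"
    unfolding st by (simp add: power2_eq_square algebra_simps)
  moreover have "0 \<le> B * (A - C)" "0 \<le> A * (B - C)" "0 \<le> C * ((A - C) + (B - C))"
    using red by (auto intro!: mult_nonneg_nonneg)
  ultimately have "0 \<le> 2 * s" "0 \<le> 2 * t" "0 \<le> 2 * (1 - s - t)"
    using D by (metis not_less zero_le_mult_iff)+
  then show ?thesis unfolding mem_triangle_iff c by (intro exI[of _ s] exI[of _ t]) simp
qed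

lemma int_spanI: "v = of_int m *\<^sub>R x + of_int n *\<^sub>R y \<Longrightarrow> v \<in> int_span x y"
  unfolding int_span_def by blast

text \<open>The open circumdisk contains no lattice point: the squared distance exceeds the squared
  radius by \<open>m * (m - 1) * A + n * (n - 1) * B + 2 * m * n * C\<close>. If
  \<open>m * n\<close> is negative, \<open>2 * C\<close> may be raised to \<open>A\<close> and
  \<open>B\<close> lowered to \<open>A\<close>, which leaves an integer multiple of
  \<open>A\<close>.\<close>

lemma circumcenter_norm_le_dist:
  assumes "reduced_pair x y" "circumcenter x y c" "l \<in> int_span x y"
  shows "norm c \<le> dist c l"
proof -
  define A B C where "A = x \<bullet> x" and "B = y \<bullet> y" and "C = x \<bullet> y"
  have red: "0 \<le> C" "2 * C \<le> A" "A \<le> B" using assms(1) by (auto simp: reduced_pair_def A_def B_def C_def)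
  obtain m n where l: "l = of_int m *\<^sub>R x + of_int n *\<^sub>R y"
    using assms(3) unfolding int_span_def by blast
  have cl: "2 * (c \<bullet> l) = of_int m * A + of_int n * B"
    using assms(2) unfolding l circumcenter_def A_def B_def inner_add_right inner_scaleR_right
    by (metis distrib_left mult.left_commute)
  have mm: "0 \<le> of_int (k * (k - 1)) * r" if "0 \<le> r" for k and r :: real
  proof -
    have "0 \<le> k * (k - 1)" by (cases "k \<le> 0") (auto intro: mult_nonpos_nonpos)
    then show ?thesis using that by (metis mult_nonneg_nonneg of_int_0_le_iff)
  qed
  have "0 \<le> of_int (m * (m - 1)) * A + of_int (n * (n - 1)) * B + of_int (m * n) * (2 * C)"
  proof (cases "0 \<le> m * n")
    case True
    then have "0 \<le> of_int (m * n) * (2 * C)" using red by (metis mult_nonneg_nonneg of_int_0_le_iff zero_le_numeral)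
    then show ?thesis using mm[of A m] mm[of B n] red by linarith
  next
    case False
    then have "of_int (m * n) * A \<le> of_int (m * n) * (2 * C)"
      using red by (intro mult_left_mono_neg) (auto simp del: of_int_mult)
    moreover have "0 \<le> of_int (n * (n - 1)) * (B - A)" using mm[of "B - A" n] red by linarith
    moreover have "0 \<le> of_int (m * (m - 1) + n * (n - 1) + m * n) * A"
    proof -
      define q where "q = m * (m - 1) + n * (n - 1) + m * n"
      \<comment> \<open>One of the two coefficients is negative, so one of the shifted squares is at
        least 4. Completing squares then shows that the integer \<open>q\<close> is
        nonnegative.\<close>
      have "m \<le> -1 \<or> n \<le> -1" using False by (smt (verit) mult_nonneg_nonneg)
      then have "4 \<le> (m - 1)\<^sup>2 \<or> 4 \<le> (n - 1)\<^sup>2"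
        using power_mono[of 2 "1 - m" 2] power_mono[of 2 "1 - n" 2] by (auto simp: power2_commute)
      then have ge: "2 \<le> (m + n)\<^sup>2 + (m - 1)\<^sup>2 + (n - 1)\<^sup>2"
        using zero_le_power2[of "m + n"] zero_le_power2[of "m - 1"] zero_le_power2[of "n - 1"] by linarith
      have "(m + n)\<^sup>2 + (m - 1)\<^sup>2 + (n - 1)\<^sup>2 = 2 * q + 2"
        by (simp add: q_def power2_eq_square algebra_simps)
      then have "0 \<le> q" using ge by linarith
      moreover have "0 \<le> A" using red by linarith
      ultimately show ?thesis by (simp flip: q_def)
    qed
    ultimately show ?thesis unfolding of_int_add distrib_right right_diff_distrib by linarith
  qed
  moreover have "(norm l)\<^sup>2 = (of_int m)\<^sup>2 * A + 2 * (of_int m * of_int n) * C + (of_int n)\<^sup>2 * B"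
    unfolding l norm_comb_sq A_def B_def C_def ..
  ultimately have "0 \<le> (norm l)\<^sup>2 - 2 * (c \<bullet> l)"
    unfolding cl by (simp add: algebra_simps power2_eq_square)
  also have "\<dots> = (dist c l)\<^sup>2 - (norm c)\<^sup>2"
    by (simp add: dist_norm power2_norm_eq_inner inner_simps inner_commute)
  finally have "(norm c)\<^sup>2 \<le> (dist c l)\<^sup>2" by simp
  then show ?thesis by (rule power2_le_imp_le) simp
qed

text \<open>The weighted mean of the squared distances from \<open>p\<close> to the vertices, with the barycentric
  coordinates of \<open>p\<close> as weights, is exactly the right-hand side.\<close>

lemma triangle_near_vertex:
  fixes x y c p :: "real^2"
  assumes "circumcenter x y c" "p \<in> convex hull {0, x, y}"
  obtains v where "v \<in> {0, x, y}" "(dist p v)\<^sup>2 \<le> (norm c)\<^sup>2 - (dist p c)\<^sup>2"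
proof -
  obtain u v where uv: "0 \<le> u" "0 \<le> v" "u + v \<le> 1" and p: "p = u *\<^sub>R x + v *\<^sub>R y"
    using assms(2) unfolding mem_triangle_iff by blast
  define R where "R = (norm c)\<^sup>2 - (dist p c)\<^sup>2"
  have c: "2 * (c \<bullet> x) = x \<bullet> x" "2 * (c \<bullet> y) = y \<bullet> y" using assms(1) by (auto simp: circumcenter_def)
  have cp: "2 * (c \<bullet> p) = u * (x \<bullet> x) + v * (y \<bullet> y)"
    unfolding p inner_add_right inner_scaleR_right using c by (simp add: algebra_simps)
  have pp: "p \<bullet> p = u * (p \<bullet> x) + v * (p \<bullet> y)"
    by (subst (2) p) (simp add: inner_simps)
  have d: "(dist p q)\<^sup>2 = p \<bullet> p - 2 * (p \<bullet> q) + q \<bullet> q" for q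
    by (simp add: dist_norm power2_norm_eq_inner inner_simps inner_commute)
  have eq: "(1 - u - v) * ((dist p 0)\<^sup>2 - R) + u * ((dist p x)\<^sup>2 - R) + v * ((dist p y)\<^sup>2 - R) = 0"
    unfolding R_def d power2_norm_eq_inner inner_zero_right using cp pp
    by (simp add: algebra_simps inner_commute)
  have "\<exists>q\<in>{0, x, y}. (dist p q)\<^sup>2 \<le> R"
  proof (rule ccontr)
    assume "\<not> ?thesis"
    then have g: "0 < (dist p 0)\<^sup>2 - R" "0 < (dist p x)\<^sup>2 - R" "0 < (dist p y)\<^sup>2 - R" by auto
    have n: "0 \<le> (1 - u - v) * ((dist p 0)\<^sup>2 - R)" "0 \<le> u * ((dist p x)\<^sup>2 - R)" "0 \<le> v * ((dist p y)\<^sup>2 - R)"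
      using uv g by (auto intro!: mult_nonneg_nonneg)
    \<comment> \<open>Nonnegative terms with sum zero all vanish. As the second factors are
      positive, all three weights would be zero, although they add up to 1.\<close>
    then have "(1 - u - v) * ((dist p 0)\<^sup>2 - R) = 0" "u * ((dist p x)\<^sup>2 - R) = 0" "v * ((dist p y)\<^sup>2 - R) = 0"
      using eq by linarith+
    then have "1 - u - v = 0" "u = 0" "v = 0" using g by (metis less_irrefl mult_eq_0_iff)+
    then show False by simp
  qed
  then show thesis using that unfolding R_def by blast
qed

lemma int_span_diff: "a \<in> int_span x y \<Longrightarrow> b \<in> int_span x y \<Longrightarrow> a - b \<in> int_span x y"
proof -
  assume "a \<in> int_span x y" "b \<in> int_span x y"
  then obtain m n p q where "a = of_int m *\<^sub>R x + of_int n *\<^sub>R y" "b = of_int p *\<^sub>R x + of_int q *\<^sub>R y"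
    unfolding int_span_def by blast
  then have "a - b = of_int (m - p) *\<^sub>R x + of_int (n - q) *\<^sub>R y" by (simp add: algebra_simps)
  then show ?thesis by (rule int_spanI)
qed

lemma int_span_scale: "a \<in> int_span x y \<Longrightarrow> of_int k *\<^sub>R a \<in> int_span x y"
proof -
  assume "a \<in> int_span x y"
  then obtain m n where "a = of_int m *\<^sub>R x + of_int n *\<^sub>R y" unfolding int_span_def by blast
  then have "of_int k *\<^sub>R a = of_int (k * m) *\<^sub>R x + of_int (k * n) *\<^sub>R y" by (simp add: algebra_simps)
  then show ?thesis by (rule int_spanI)
qed

lemma int_span_add:
  assumes "a \<in> int_span x y" "b \<in> int_span x y"
  shows "a + b \<in> int_span x y"
proof -
  have "a - (0 - b) \<in> int_span x y" by (intro int_span_diff assms in_int_span_basis)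
  then show ?thesis by simp
qed

lemma int_span_subset:
  assumes "a \<in> int_span x y" "b \<in> int_span x y"
  shows "int_span a b \<subseteq> int_span x y"
proof
  fix v assume "v \<in> int_span a b"
  then obtain m n where "v = of_int m *\<^sub>R a + of_int n *\<^sub>R b" unfolding int_span_def by blast
  then show "v \<in> int_span x y" using assms by (simp add: int_span_add int_span_scale)
qed

text \<open>A lattice translation moves \<open>p\<close> into the fundamental parallelogram, which
  the diagonal from \<open>x\<close> to \<open>y\<close> cuts into the triangle and its image under
  the point reflection \<open>q \<mapsto> x + y - q\<close>. This reflection preserves the
  lattice.\<close>

lemma covering_radius_le:
  assumes det: "x $ 1 * y $ 2 - x $ 2 * y $ 1 \<noteq> 0" and "circumcenter x y c"
  obtains l where "l \<in> int_span x y" "dist p l \<le> norm c"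
proof -
  have near: "\<exists>l\<in>int_span x y. dist q l \<le> norm c" if "q \<in> convex hull {0, x, y}" for q
  proof -
    obtain v where v: "v \<in> {0, x, y}" "(dist q v)\<^sup>2 \<le> (norm c)\<^sup>2 - (dist q c)\<^sup>2"
      using triangle_near_vertex[OF assms(2) \<open>q \<in> _\<close>] .
    then have "(dist q v)\<^sup>2 \<le> (norm c)\<^sup>2" using zero_le_power2[of "dist q c"] by linarith
    then have "dist q v \<le> norm c" by (rule power2_le_imp_le) simp
    then show ?thesis using v(1) in_int_span_basis by blast
  qed
  obtain u v where p: "p = u *\<^sub>R x + v *\<^sub>R y" using coordinates_exist[OF det] .
  define f where "f = of_int \<lfloor>u\<rfloor> *\<^sub>R x + of_int \<lfloor>v\<rfloor> *\<^sub>R y"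
  have f: "f \<in> int_span x y" unfolding f_def by (rule int_spanI) (rule refl)
  have q: "p - f = frac u *\<^sub>R x + frac v *\<^sub>R y" by (simp add: p f_def frac_def algebra_simps)
  have fr: "0 \<le> frac u" "0 \<le> frac v" "frac u \<le> 1" "frac v \<le> 1"
    using frac_ge_0 frac_lt_1[of u] frac_lt_1[of v] by auto
  show thesis
  proof (cases "frac u + frac v \<le> 1")
    case True
    then have "p - f \<in> convex hull {0, x, y}" unfolding mem_triangle_iff q using fr by blast
    then obtain l where l: "l \<in> int_span x y" "dist (p - f) l \<le> norm c" using near by blast
    have "dist (p - f) l = dist p (f + l)" by (simp add: dist_norm algebra_simps)
    then show thesis using that[of "f + l"] l f int_span_add by simp
  next
    case False
    \<comment> \<open>Beyond the diagonal, the point is reflected into the triangle first.\<close>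
    have "x + y - (p - f) = (1 - frac u) *\<^sub>R x + (1 - frac v) *\<^sub>R y" unfolding q by (simp add: algebra_simps)
    then have "x + y - (p - f) \<in> convex hull {0, x, y}" unfolding mem_triangle_iff using fr False
      by (intro exI[of _ "1 - frac u"] exI[of _ "1 - frac v"]) simp
    then obtain l where l: "l \<in> int_span x y" "dist (x + y - (p - f)) l \<le> norm c" using near by blast
    have "dist (x + y - (p - f)) l = dist p (x + y + f - l)"
      using norm_minus_commute[of "x + y + f" "p + l"] by (simp add: dist_norm algebra_simps)
    moreover have "x + y + f - l \<in> int_span x y"
      by (intro int_span_diff int_span_add in_int_span_basis f l)
    ultimately show thesis using that[of "x + y + f - l"] l by simp
  qed
qed

text \<open>The covering radius is \<open>norm c\<close>: the empty circumdisk gives the lower bound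
  at \<open>c\<close>, the covering by triangles the upper bound everywhere. Any other point of the
  triangle is strictly closer than \<open>norm c\<close> to some vertex.\<close>

lemma deep_hole_in_triangle_iff:
  assumes det: "x $ 1 * y $ 2 - x $ 2 * y $ 1 \<noteq> 0" and red: "reduced_pair x y"
    and c: "circumcenter x y c" and z: "z \<in> convex hull {0, x, y}"
  shows "deep_hole (int_span x y) z \<longleftrightarrow> z = c"
proof -
  let ?L = "int_span x y"
  have ne: "?L \<noteq> {}" using in_int_span_basis by blast
  have ge: "norm c \<le> infdist c ?L"
    unfolding infdist_notempty[OF ne] by (intro cINF_greatest ne circumcenter_norm_le_dist[OF red c])
  show ?thesis
  proof
    assume "deep_hole ?L z"
    then have le: "norm c \<le> infdist z ?L" using ge by (auto simp: deep_hole_def intro: order_trans)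
    obtain v where v: "v \<in> {0, x, y}" "(dist z v)\<^sup>2 \<le> (norm c)\<^sup>2 - (dist z c)\<^sup>2"
      using triangle_near_vertex[OF c z] .
    have "infdist z ?L \<le> dist z v" using v(1) in_int_span_basis by (intro infdist_le) blast
    then have "(norm c)\<^sup>2 \<le> (dist z v)\<^sup>2" using le by (intro power_mono) auto
    then have "(dist z c)\<^sup>2 \<le> 0" using v(2) by linarith
    then show "z = c" by simp
  next
    assume zc: "z = c"
    show "deep_hole ?L z" unfolding deep_hole_def zc
    proof
      fix p
      obtain l where "l \<in> ?L" "dist p l \<le> norm c" using covering_radius_le[OF det c] .
      then show "infdist p ?L \<le> infdist c ?L" using infdist_le[of l ?L p] ge by linarith
    qed
  qed
qed

text \<open>Successive minima, angles and maximal distances disappear: what remains is the choice of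
  a reduced basis and two linear equations for \<open>c\<close>.\<close>

lemma deep_hole_lattice_iff:
  assumes "lattice_basis L e1 e2" "reduced_pair e1 e2"
  shows "deep_hole_lattice L M \<longleftrightarrow>
    (\<exists>x y c. lattice_basis L x y \<and> reduced_pair x y \<and> circumcenter x y c \<and> M = int_span x c)"
proof
  assume "deep_hole_lattice L M"
  then obtain x y z where z: "lattice_basis L x y" "reduced_pair x y" "deep_hole L z"
    "z \<in> convex hull {0, x, y}" "M = int_span x z"
    unfolding deep_hole_lattice_def minimal_basis_iff[OF assms] by blast
  then have det: "x $ 1 * y $ 2 - x $ 2 * y $ 1 \<noteq> 0" "L = int_span x y" by (auto simp: lattice_basis_iff)
  obtain c where c: "circumcenter x y c" using circumcenter_exists[OF det(1)] .
  then have "z = c" using z det deep_hole_in_triangle_iff by blast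
  then show "\<exists>x y c. lattice_basis L x y \<and> reduced_pair x y \<and> circumcenter x y c \<and> M = int_span x c"
    using z c by blast
next
  assume "\<exists>x y c. lattice_basis L x y \<and> reduced_pair x y \<and> circumcenter x y c \<and> M = int_span x c"
  then obtain x y c where c: "lattice_basis L x y" "reduced_pair x y" "circumcenter x y c" "M = int_span x c"
    by blast
  then have det: "x $ 1 * y $ 2 - x $ 2 * y $ 1 \<noteq> 0" "L = int_span x y" by (auto simp: lattice_basis_iff)
  have "c \<in> convex hull {0, x, y}" using circumcenter_in_triangle[OF det(1)] c by blast
  moreover from this have "deep_hole L c" using c det deep_hole_in_triangle_iff by blast
  ultimately show "deep_hole_lattice L M"
    unfolding deep_hole_lattice_def minimal_basis_iff[OF assms] using c by blast
qed

section \<open>Generators of the lattices and similarity\<close>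

lemma Lat_eq_int_span: "Lat \<tau> = int_span (vector [1, 0]) (vector [Re \<tau>, Im \<tau>])"
proof -
  \<comment> \<open>The nested \<open>vector\<close> lists the rows of the matrix, so the generators
    are its columns.\<close>
  have e: "(vector [vector [1, Re \<tau>], vector [0, Im \<tau>]] :: real^2^2) *v v
      = v $ 1 *\<^sub>R vector [1, 0] + v $ 2 *\<^sub>R vector [Re \<tau>, Im \<tau>]" for v
    by (simp add: vec_eq_real2 matrix_vector_mult_def sum_2 mult.commute)
  show ?thesis
  proof (intro equalityI subsetI)
    fix p assume "p \<in> Lat \<tau>"
    then obtain v where v: "v $ (1::2) \<in> \<int>" "v $ (2::2) \<in> \<int>" "p = v $ (1::2) *\<^sub>R vector [1, 0] + v $ (2::2) *\<^sub>R vector [Re \<tau>, Im \<tau>]"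
      unfolding Lat_def e by blast
    then obtain m n where "v $ 1 = of_int m" "v $ 2 = of_int n" by (auto elim!: Ints_cases)
    then show "p \<in> int_span (vector [1, 0]) (vector [Re \<tau>, Im \<tau>])" using v(3) int_spanI by metis
  next
    fix p :: "real^2" assume "p \<in> int_span (vector [1, 0]) (vector [Re \<tau>, Im \<tau>])"
    then obtain m n where p: "p = of_int m *\<^sub>R vector [1, 0] + of_int n *\<^sub>R vector [Re \<tau>, Im \<tau>]"
      unfolding int_span_def by blast
    let ?v = "vector [of_int m, of_int n] :: real^2"
    have "\<forall>i. ?v $ i \<in> \<int>" by (simp add: forall_2)
    moreover have "p = (vector [vector [1, Re \<tau>], vector [0, Im \<tau>]] :: real^2^2) *v ?v"
      unfolding e p by simp
    ultimately show "p \<in> Lat \<tau>" unfolding Lat_def by blast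
  qed
qed

text \<open>The linear map from one basis to the other vectors preserves every norm, since a norm
  depends only on the coordinates and the Gram matrix.\<close>

lemma orthogonal_matrix_of_gram:
  fixes x y X Y :: "real^2"
  assumes det: "x $ 1 * y $ 2 - x $ 2 * y $ 1 \<noteq> 0" and "X \<bullet> X = x \<bullet> x" "X \<bullet> Y = x \<bullet> y" "Y \<bullet> Y = y \<bullet> y"
  obtains U :: "real^2^2" where "orthogonal_matrix U" "U *v x = X" "U *v y = Y"
proof -
  have ind: "independent {x, y}" "x \<noteq> y" using det independent_iff_det by blast+
  obtain f where f: "linear f" "\<And>v. v \<in> {x, y} \<Longrightarrow> f v = (if v = x then X else Y)"
    using linear_independent_extend[OF ind(1), of "\<lambda>v. if v = x then X else Y"] by blast
  have fxy: "f x = X" "f y = Y" using f(2) ind(2) by auto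
  have "norm (f v) = norm v" for v
  proof -
    obtain s t where v: "v = s *\<^sub>R x + t *\<^sub>R y" using coordinates_exist[OF det] .
    then have "f v = s *\<^sub>R X + t *\<^sub>R Y" using f(1) fxy by (simp add: linear_add linear_scale)
    then have "(norm (f v))\<^sup>2 = (norm v)\<^sup>2" by (simp only: v norm_comb_sq assms)
    then show ?thesis by simp
  qed
  then have "orthogonal_transformation f" using f(1) by (simp add: orthogonal_transformation)
  then have "orthogonal_matrix (matrix f)" by (simp add: orthogonal_transformation_matrix)
  then show thesis using that[of "matrix f"] f(1) fxy by (simp add: matrix_works)
qed

text \<open>The vectors \<open>c\<close> and \<open>x - c\<close> generate the same lattice as \<open>x\<close> and \<open>c\<close>, and their Gram matrix is
  a multiple of that of \<open>x\<close> and \<open>y\<close>.\<close>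

lemma deep_hole_lattice_similar:
  assumes "lattice_basis L x y" "reduced_pair x y" "circumcenter x y c" "norm x = norm y"
  shows "similar_lattices L (int_span x c)"
proof -
  have det: "x $ 1 * y $ 2 - x $ 2 * y $ 1 \<noteq> 0" and L: "L = int_span x y"
    using assms(1) by (auto simp: lattice_basis_iff)
  define A C R where "A = x \<bullet> x" and "C = x \<bullet> y" and "R = c \<bullet> c"
  have B: "y \<bullet> y = A" using assms(4) by (simp add: A_def dot_square_norm)
  have cc: "2 * (c \<bullet> x) = A" "2 * (c \<bullet> y) = A" using assms(3) B by (simp_all add: circumcenter_def A_def)
  have D: "0 < A * A - C\<^sup>2" using gram_eq_det_sq[of x y] det by (simp add: A_def C_def B)
  obtain s t where c: "c = s *\<^sub>R x + t *\<^sub>R y" using coordinates_exist[OF det] .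
  have e: "2 * (s * A + t * C) = A" "2 * (s * C + t * A) = A"
    using cc by (simp_all add: c A_def[symmetric] C_def inner_simps inner_commute)
      (simp_all add: B inner_commute)
  have "x \<noteq> 0" using det by auto
  then have A0: "0 < A" by (simp add: A_def)
  have "2 * R = (s + t) * A"
    using cc unfolding R_def by (subst (2) c) (simp add: inner_simps algebra_simps)
  moreover have "2 * ((s + t) * (A + C)) = 2 * A" using e by (simp add: algebra_simps)
  then have "(s + t) * (A + C) = A" by simp
  \<comment> \<open>For two sides of equal length this determines the squared circumradius
    \<open>R\<close>; it is what makes the inner product of \<open>c\<close> and
    \<open>x - c\<close> proportional to \<open>C\<close>.\<close>
  ultimately have RA: "2 * R * (A + C) = A * A" by (metis mult.assoc mult.commute)
  have AC: "0 < A + C" using A0 assms(2) by (simp add: reduced_pair_def C_def)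
  have "0 < 2 * R * (A + C)" unfolding RA using A0 by simp
  then have R0: "0 < R" using AC by (simp add: zero_less_mult_iff)
  \<comment> \<open>The similarity is to send \<open>x\<close> to \<open>c\<close> and
    \<open>y\<close> to \<open>x - c\<close>, so its factor is the circumradius divided by the side
    length.\<close>
  define k where "k = sqrt (R / A)"
  have k0: "0 < k" and k2: "k * k = R / A" using A0 R0 by (simp_all add: k_def)
  have k3: "inverse k * inverse k = A / R" using k2 by (simp flip: inverse_mult_distrib)
  have "(inverse k *\<^sub>R c) \<bullet> (inverse k *\<^sub>R c) = (inverse k * inverse k) * R" by (simp add: R_def)
  then have 1: "(inverse k *\<^sub>R c) \<bullet> (inverse k *\<^sub>R c) = x \<bullet> x" using R0 by (simp add: k3 A_def)
  have "(inverse k *\<^sub>R c) \<bullet> (inverse k *\<^sub>R (x - c)) = (inverse k * inverse k) * (A / 2 - R)"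
    using cc by (simp add: R_def inner_simps algebra_simps)
  also have "\<dots> = C" using RA R0 unfolding k3 by (simp add: field_simps)
  finally have 2: "(inverse k *\<^sub>R c) \<bullet> (inverse k *\<^sub>R (x - c)) = x \<bullet> y" by (simp add: C_def)
  have "(inverse k *\<^sub>R (x - c)) \<bullet> (inverse k *\<^sub>R (x - c)) = (inverse k * inverse k) * R"
    using cc by (simp add: R_def A_def inner_simps inner_commute algebra_simps)
  then have 3: "(inverse k *\<^sub>R (x - c)) \<bullet> (inverse k *\<^sub>R (x - c)) = y \<bullet> y" using R0 by (simp add: k3 B)
  obtain U :: "real^2^2" where U: "orthogonal_matrix U" "U *v x = inverse k *\<^sub>R c" "U *v y = inverse k *\<^sub>R (x - c)"
    using orthogonal_matrix_of_gram[OF det 1 2 3] .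
  have im: "k *\<^sub>R (U *v (p *\<^sub>R x + q *\<^sub>R y)) = p *\<^sub>R c + q *\<^sub>R (x - c)" for p q
    using U k0 by (simp add: matrix_vector_right_distrib matrix_vector_mult_scaleR scaleR_add_right mult.left_commute[of k])
  have "(\<lambda>v. k *\<^sub>R (U *v v)) ` L = int_span c (x - c)"
    unfolding L int_span_def using im by (auto simp: image_iff) metis+
  also have "\<dots> = int_span x c"
  proof (intro equalityI int_span_subset)
    have "c + (x - c) \<in> int_span c (x - c)" by (intro int_span_add in_int_span_basis)
    then show "x \<in> int_span c (x - c)" by simp
  qed (auto intro: in_int_span_basis int_span_diff)
  finally show ?thesis unfolding similar_lattices_def using k0 U(1) by metis
qed

section \<open>One step on the parameter\<close>

lemma real_subfield_half_quotient:
  assumes "real_subfield K" "a \<in> K" "b \<in> K"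
  shows "(a\<^sup>2 + b\<^sup>2 - a) / (2 * b) \<in> K"
proof -
  have add: "x + y \<in> K" and mult: "x * y \<in> K" if "x \<in> K" "y \<in> K" for x y
    using assms(1) that by (auto simp: real_subfield_def)
  have minus: "- x \<in> K" and inv: "inverse x \<in> K" if "x \<in> K" for x
    using assms(1) that by (auto simp: real_subfield_def)
  note a = assms(2) and b = assms(3)
  show ?thesis
    \<comment> \<open>The case \<open>b = 0\<close> is covered by the convention
      \<open>inverse 0 = 0\<close>.\<close>
    unfolding divide_inverse power2_eq_square mult_2 diff_conv_add_uminus
    by (rule mult[OF add[OF add[OF mult[OF a a] mult[OF b b]] minus[OF a]] inv[OF add[OF b b]]])
qed

text \<open>The lowest point of the domain is its corner exp(i pi/3).\<close>

lemma fund_dom_Im_ge: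
  assumes "\<tau> \<in> fund_dom"
  shows "sqrt 3 / 2 \<le> Im \<tau>"
proof -
  have "1 \<le> (Re \<tau>)\<^sup>2 + (Im \<tau>)\<^sup>2" and re: "\<bar>Re \<tau>\<bar> \<le> 1 / 2" and im: "0 \<le> Im \<tau>"
    using assms by (auto simp: fund_dom_def cmod_def)
  moreover have "(Re \<tau>)\<^sup>2 \<le> (1 / 2)\<^sup>2" using re by (metis abs_le_square_iff abs_of_nonneg zero_le_divide_1_iff zero_le_numeral)
  ultimately have "(sqrt 3 / 2)\<^sup>2 \<le> (Im \<tau>)\<^sup>2" by (simp add: power_divide)
  then show ?thesis using im by (rule power2_le_imp_le)
qed

text \<open>For \<open>Im \<tau> \<noteq> 0\<close> this is the circumcenter of 0, 1 and
  \<open>\<tau>\<close>: the real part makes it equidistant from 0 and 1, the imaginary part from 0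
  and \<open>\<tau>\<close>.\<close>

definition next_parameter :: "complex \<Rightarrow> complex" where
  "next_parameter \<tau> = Complex (1 / 2) (((Re \<tau>)\<^sup>2 + (Im \<tau>)\<^sup>2 - Re \<tau>) / (2 * Im \<tau>))"

text \<open>The strict inequality makes the shortest vector unique up to sign. Every reduced basis
  then arises from \<open>e1\<close>, \<open>e2\<close> by sign changes of the two coordinates, and
  its circumcenter differs from plus or minus \<open>(1 / 2, h)\<close> by a multiple of
  \<open>e1\<close>. The lattice is therefore independent of the choice.\<close>

lemma deep_hole_lattice_Lat:
  assumes "\<tau> \<in> fund_dom" "1 < cmod \<tau>"
  shows "deep_hole_lattice (Lat \<tau>) M \<longleftrightarrow> M = Lat (next_parameter \<tau>)"
proof -
  define a b where "a = Re \<tau>" and "b = Im \<tau>"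
  define e1 e2 :: "real^2" where "e1 = vector [1, 0]" and "e2 = vector [a, b]"
  define h where "h = (a\<^sup>2 + b\<^sup>2 - a) / (2 * b)"
  have b0: "0 < b" using fund_dom_Im_ge[OF assms(1)] unfolding b_def by (smt (verit) real_sqrt_gt_zero divide_pos_pos)
  have a: "0 \<le> a" "2 * a \<le> 1" using assms(1) by (auto simp: fund_dom_def a_def)
  have ab: "1 < a\<^sup>2 + b\<^sup>2" using assms(2) by (simp add: cmod_def a_def b_def)
  have e: "e1 $ 1 = 1" "e1 $ 2 = 0" "e2 $ 1 = a" "e2 $ 2 = b" by (simp_all add: e1_def e2_def)
  have L: "Lat \<tau> = int_span e1 e2" by (simp add: Lat_eq_int_span e1_def e2_def a_def b_def)
  have lb: "lattice_basis (Lat \<tau>) e1 e2" using b0 by (simp add: lattice_basis_iff L e)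
  have red: "reduced_pair e1 e2" using a ab by (simp add: reduced_pair_def inner_real2 e power2_eq_square)
  have N: "Lat (next_parameter \<tau>) = int_span e1 (vector [1 / 2, h])"
    by (simp add: Lat_eq_int_span next_parameter_def e1_def h_def a_def b_def)
  have hb: "2 * h * b = a\<^sup>2 + b\<^sup>2 - a" using b0 by (simp add: h_def)
  show ?thesis unfolding deep_hole_lattice_iff[OF lb red]
  proof
    assume "M = Lat (next_parameter \<tau>)"
    moreover have "circumcenter e1 e2 (vector [1 / 2, h])"
      using hb by (simp add: circumcenter_def inner_real2 e power2_eq_square algebra_simps)
    ultimately show "\<exists>x y c. lattice_basis (Lat \<tau>) x y \<and> reduced_pair x y \<and> circumcenter x y c \<and> M = int_span x c"
      using lb red N by blast
  next
    assume "\<exists>x y c. lattice_basis (Lat \<tau>) x y \<and> reduced_pair x y \<and> circumcenter x y c \<and> M = int_span x c"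
    then obtain x y c where xy: "lattice_basis (Lat \<tau>) x y" "reduced_pair x y" and c: "circumcenter x y c"
      and M: "M = int_span x c" by blast
    have n: "x \<bullet> x = 1" "y \<bullet> y = a\<^sup>2 + b\<^sup>2"
      using succ_min_reduced[OF lb red] succ_min_reduced[OF xy]
      by (simp_all add: norm_eq inner_real2 e power2_eq_square)
    have L': "int_span x y = int_span e1 e2" using xy(1) L by (simp add: lattice_basis_iff)
    then have "x \<in> int_span e1 e2" "y \<in> int_span e1 e2" "e2 \<in> int_span x y"
      using in_int_span_basis by metis+
    then obtain m n p q r s where mn: "x = of_int m *\<^sub>R e1 + of_int n *\<^sub>R e2"
      and pq: "y = of_int p *\<^sub>R e1 + of_int q *\<^sub>R e2"
      and rs: "e2 = of_int r *\<^sub>R x + of_int s *\<^sub>R y"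
      unfolding int_span_def by blast
    have "n = 0"
    proof (rule ccontr)
      assume "n \<noteq> 0"
      then have "norm e2 \<le> norm x" using reduced_norm_ge_snd[OF red] mn by blast
      then have "a\<^sup>2 + b\<^sup>2 \<le> 1" using n(1) by (simp add: norm_le inner_real2 e power2_eq_square)
      then show False using ab by simp
    qed
    then have x: "x $ 1 = of_int m" "x $ 2 = 0" using mn e by simp_all
    have y: "y $ 1 = of_int p + of_int q * a" "y $ 2 = of_int q * b" using pq e by simp_all
    have "of_int (m * m) = (1::real)" using n(1) x by (simp add: inner_real2)
    then have "m * m = 1" by linarith
    then have m: "m = 1 \<or> m = -1" by (auto simp: zmult_eq_1_iff)
    \<comment> \<open>The second coordinate of \<open>e2\<close>, expressed in the basis
      \<open>x\<close>, \<open>y\<close>, shows that \<open>q\<close> is a unit.\<close>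
    have "b = of_int s * (of_int q * b)" using arg_cong[OF rs, of "\<lambda>v. v $ 2"] x y e by simp
    then have "of_int (s * q) = (1::real)" using b0 by simp
    then have "s * q = 1" by linarith
    then have q: "q = 1 \<or> q = -1" by (auto simp: zmult_eq_1_iff)
    have qq: "real_of_int q * real_of_int q = 1" and mm: "real_of_int m * real_of_int m = 1"
      using q m by auto
    \<comment> \<open>The length of \<open>y\<close> fixes its first coordinate up to sign;
      \<open>0 \<le> x \<bullet> y\<close> then decides the sign.\<close>
    have "(y $ 1)\<^sup>2 = a\<^sup>2"
      using n(2) q unfolding inner_real2 y(2) by (auto simp: power2_eq_square)
    then have "(of_int m * y $ 1)\<^sup>2 = a\<^sup>2" using m by auto
    moreover have "0 \<le> of_int m * y $ 1" using xy(2) x by (simp add: reduced_pair_def inner_real2)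
    ultimately have my: "of_int m * y $ 1 = a" using a(1) by (simp add: power2_eq_iff_nonneg)
    have c1: "2 * c $ 1 = of_int m"
      using c n(1) x m by (auto simp: circumcenter_def inner_real2)
    have "2 * (c $ 1 * y $ 1 + c $ 2 * y $ 2) = a\<^sup>2 + b\<^sup>2"
      using c n(2) by (simp add: circumcenter_def inner_real2)
    moreover have "2 * (c $ 1 * y $ 1) = a" using c1 my by (simp flip: mult.assoc)
    moreover have "c $ 2 * y $ 2 = c $ 2 * of_int q * b" by (simp add: y(2))
    ultimately have "2 * (c $ 2 * of_int q * b) = 2 * h * b"
      using hb unfolding distrib_left by linarith
    then have "c $ 2 * of_int q = h" using b0 by simp
    then have c2: "c $ 2 = of_int q * h" using q by auto
    let ?h = "vector [1 / 2, h] :: real^2"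
    \<comment> \<open>Both \<open>m\<close> and \<open>q\<close> are odd, so half their difference
      is an integer.\<close>
    obtain k where k: "of_int m / 2 = of_int k + of_int q / (2::real)"
    proof -
      have "of_int m / 2 = of_int ((m - q) div 2) + of_int q / (2::real)" using m q by auto
      then show thesis by (rule that)
    qed
    have xe: "x = of_int m *\<^sub>R e1" "e1 = of_int m *\<^sub>R x"
      using m x e by (auto simp: vec_eq_real2)
    have ch: "c = of_int k *\<^sub>R e1 + of_int q *\<^sub>R ?h"
      using c1 c2 k e by (simp add: vec_eq_real2)
    have hc: "?h = of_int (- (q * k * m)) *\<^sub>R x + of_int q *\<^sub>R c"
    proof -
      have "of_int (- (q * k * m)) * x $ 1 = - (real_of_int q * of_int k)"
        using mm by (simp add: x(1) mult.assoc)
      moreover have "c $ 1 = of_int k + of_int q / 2" using c1 k by linarith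
      then have "of_int q * c $ 1 = of_int q * of_int k + 1 / 2" using qq by (simp add: distrib_left)
      moreover have "of_int q * c $ 2 = h" using q by (auto simp: c2)
      ultimately show ?thesis
        unfolding vec_eq_real2 vector_add_component vector_scaleR_component real_scaleR_def by (simp add: x(2))
    qed
    have "int_span x c = int_span e1 ?h"
    proof (intro equalityI int_span_subset)
      show "x \<in> int_span e1 ?h" unfolding xe(1) by (intro int_span_scale in_int_span_basis)
      show "e1 \<in> int_span x c" unfolding xe(2) by (intro int_span_scale in_int_span_basis)
      show "c \<in> int_span e1 ?h" using ch by (rule int_spanI)
      show "?h \<in> int_span x c" using hc by (rule int_spanI)
    qed
    then show "M = Lat (next_parameter \<tau>)" by (simp add: M N)
  qed
qed

text \<open>The minimum is attained at the corner of the domain. The bound keeps the last parameter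
  high enough for a reduced basis of equal norms.\<close>

lemma next_parameter_Im_ge:
  assumes "\<tau> \<in> fund_dom"
  shows "sqrt 3 / 6 \<le> Im (next_parameter \<tau>)"
proof -
  define a b where "a = Re \<tau>" and "b = Im \<tau>"
  have b: "sqrt 3 / 2 \<le> b" using fund_dom_Im_ge[OF assms] by (simp add: b_def)
  then have b0: "0 < b" by (smt (verit) real_sqrt_gt_zero divide_pos_pos)
  \<comment> \<open>This factors the quadratic \<open>b\<^sup>2 - b * (sqrt 3 / 3) - 1 / 4\<close>;
    the remaining 1/4 is absorbed by \<open>(a - 1 / 2)\<^sup>2\<close>.\<close>
  have "0 \<le> (b - sqrt 3 / 2) * (b + sqrt 3 / 6)" using b b0 by (intro mult_nonneg_nonneg) auto
  then have s: "b * (sqrt 3 / 3) \<le> b\<^sup>2 - 1 / 4" by (simp add: power2_eq_square algebra_simps)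
  have "0 \<le> (a - 1 / 2)\<^sup>2" by simp
  then have "b * (sqrt 3 / 3) \<le> a\<^sup>2 + b\<^sup>2 - a" using s by (simp add: power2_eq_square algebra_simps)
  then have "sqrt 3 / 6 * (2 * b) \<le> a\<^sup>2 + b\<^sup>2 - a" by (simp add: mult.commute)
  then have "sqrt 3 / 6 \<le> (a\<^sup>2 + b\<^sup>2 - a) / (2 * b)" using b0 by (subst pos_le_divide_eq) auto
  then show ?thesis by (simp add: next_parameter_def a_def b_def)
qed

text \<open>As \<open>a\<close> lies in [0, 1], \<open>a\<^sup>2 - a\<close> is at most 0. This
  halving is the source of the logarithm.\<close>

lemma next_parameter_Im_le:
  assumes "\<tau> \<in> fund_dom"
  shows "Im (next_parameter \<tau>) \<le> Im \<tau> / 2"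
proof -
  define a b where "a = Re \<tau>" and "b = Im \<tau>"
  have b: "sqrt 3 / 2 \<le> b" using fund_dom_Im_ge[OF assms] by (simp add: b_def)
  then have b0: "0 < b" by (smt (verit) real_sqrt_gt_zero divide_pos_pos)
  have a: "0 \<le> a" "a \<le> 1" using assms by (auto simp: fund_dom_def a_def)
  have "a * a \<le> a * 1" using a by (intro mult_left_mono) auto
  then have "a\<^sup>2 + b\<^sup>2 - a \<le> b / 2 * (2 * b)" by (simp add: power2_eq_square)
  then have "(a\<^sup>2 + b\<^sup>2 - a) / (2 * b) \<le> b / 2" using b0 by (subst pos_divide_le_eq) auto
  then show ?thesis by (simp add: next_parameter_def a_def b_def)
qed

section \<open>The well-rounded end of the sequence\<close>

text \<open>On the unit circle the standard basis works. For real part 1/2, \<open>e2\<close> and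
  \<open>e1 - e2\<close> have equal norms and inner product \<open>1 / 4 - b * b\<close>, so the
  sign of the second vector depends on whether \<open>b * b\<close> exceeds 1/4. The angle stays at
  least pi/3 by the lower bound on \<open>Im \<tau>\<close> in one case and by
  \<open>cmod \<tau> \<le> 1\<close> in the other.\<close>

lemma Lat_equal_norm_basis:
  assumes "(\<tau> \<in> fund_dom \<and> cmod \<tau> = 1) \<or> (Re \<tau> = 1 / 2 \<and> sqrt 3 / 6 \<le> Im \<tau> \<and> cmod \<tau> \<le> 1)"
  obtains x y where "lattice_basis (Lat \<tau>) x y" "reduced_pair x y" "norm x = norm y"
  using assms
proof
  define a b where "a = Re \<tau>" and "b = Im \<tau>"
  define e1 e2 :: "real^2" where "e1 = vector [1, 0]" and "e2 = vector [a, b]"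
  have e: "e1 $ 1 = 1" "e1 $ 2 = 0" "e2 $ 1 = a" "e2 $ 2 = b" by (simp_all add: e1_def e2_def)
  have L: "Lat \<tau> = int_span e1 e2" by (simp add: Lat_eq_int_span e1_def e2_def a_def b_def)
  {
    assume A: "\<tau> \<in> fund_dom \<and> cmod \<tau> = 1"
    have b0: "0 < b" using fund_dom_Im_ge A unfolding b_def by (smt (verit) real_sqrt_gt_zero divide_pos_pos)
    have a: "0 \<le> a" "2 * a \<le> 1" using A by (auto simp: fund_dom_def a_def)
    have ab: "a\<^sup>2 + b\<^sup>2 = 1" using A by (simp add: cmod_def a_def b_def)
    have lb: "lattice_basis (Lat \<tau>) e1 e2" using b0 by (simp add: lattice_basis_iff L e)
    have "reduced_pair e1 e2" using a ab by (simp add: reduced_pair_def inner_real2 e power2_eq_square)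
    moreover have "norm e1 = norm e2" using ab by (simp add: norm_eq inner_real2 e power2_eq_square)
    ultimately show thesis using lb that by blast
  next
    assume A: "Re \<tau> = 1 / 2 \<and> sqrt 3 / 6 \<le> Im \<tau> \<and> cmod \<tau> \<le> 1"
    have a: "a = 1 / 2" and b: "sqrt 3 / 6 \<le> b" using A by (simp_all add: a_def b_def)
    then have b0: "0 < b" by (smt (verit) real_sqrt_gt_zero divide_pos_pos)
    have "(sqrt 3 / 6)\<^sup>2 \<le> b\<^sup>2" using b by (intro power_mono) auto
    then have lo: "1 / 12 \<le> b * b" by (simp add: power_divide power2_eq_square)
    have "a\<^sup>2 + b\<^sup>2 \<le> 1" using A by (simp add: cmod_def a_def b_def)
    then have hi: "b * b \<le> 3 / 4" by (simp add: a power2_eq_square)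
    have span: "int_span e2 (e1 - e2) = Lat \<tau>" "int_span e2 (e2 - e1) = Lat \<tau>"
    proof -
      have "e2 + (e1 - e2) \<in> int_span e2 (e1 - e2)" "e2 - (e2 - e1) \<in> int_span e2 (e2 - e1)"
        by (intro int_span_add int_span_diff in_int_span_basis)+
      then have "e1 \<in> int_span e2 (e1 - e2)" "e1 \<in> int_span e2 (e2 - e1)" by simp_all
      then show "int_span e2 (e1 - e2) = Lat \<tau>" "int_span e2 (e2 - e1) = Lat \<tau>" unfolding L
        by (intro equalityI int_span_subset int_span_diff in_int_span_basis; simp)+
    qed
    show thesis
    proof (cases "b * b \<le> 1 / 4")
      case True
      show thesis
      proof (rule that)
        show "lattice_basis (Lat \<tau>) e2 (e1 - e2)" using b0 by (simp add: lattice_basis_iff span e a)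
        show "reduced_pair e2 (e1 - e2)" using True lo by (simp add: reduced_pair_def inner_real2 e a)
        show "norm e2 = norm (e1 - e2)" by (simp add: norm_eq inner_real2 e a)
      qed
    next
      case False
      show thesis
      proof (rule that)
        show "lattice_basis (Lat \<tau>) e2 (e2 - e1)" using b0 by (simp add: lattice_basis_iff span e a)
        show "reduced_pair e2 (e2 - e1)" using False hi by (simp add: reduced_pair_def inner_real2 e a)
        show "norm e2 = norm (e2 - e1)" by (simp add: norm_eq inner_real2 e a)
      qed
    qed
  }
qed

text \<open>The norms in any reduced basis are the successive minima, so one reduced basis of equal
  norms forces all of them to be so. Hence similarity holds for every choice of the minimal
  basis.\<close>

lemma deep_hole_lattice_of_equal_norm_basis:
  assumes lb: "lattice_basis L x y" and red: "reduced_pair x y" and eq: "norm x = norm y"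
  shows "well_rounded L" "\<exists>M. deep_hole_lattice L M"
    "\<And>M. deep_hole_lattice L M \<Longrightarrow> similar_lattices L M"
proof -
  show "well_rounded L" unfolding well_rounded_def using succ_min_reduced[OF lb red] lb eq by auto
  obtain c where "circumcenter x y c" using circumcenter_exists lb by (auto simp: lattice_basis_iff)
  then show "\<exists>M. deep_hole_lattice L M" unfolding deep_hole_lattice_iff[OF lb red] using lb red by blast
  fix M assume "deep_hole_lattice L M"
  then obtain u v c where u: "lattice_basis L u v" "reduced_pair u v" "circumcenter u v c" "M = int_span u c"
    unfolding deep_hole_lattice_iff[OF lb red] by blast
  have "norm u = norm v" using succ_min_reduced[OF lb red] succ_min_reduced[OF u(1,2)] eq by simp
  then show "similar_lattices L M" using deep_hole_lattice_similar u by blast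
qed

section \<open>Construction of the sequence and the bound on its length\<close>

theorem theorem1p2:
  fixes K :: "real set" and \<tau>0 :: complex
  assumes "real_subfield K"
    and "\<tau>0 \<in> fund_dom"
    and "Re \<tau>0 \<in> K" and "Im \<tau>0 \<in> K"
  shows "\<exists>(n::nat) (\<tau> :: nat \<Rightarrow> complex).
    \<tau> 0 = \<tau>0 \<and>
    (\<forall>k\<in>{1..n}.
       Re (\<tau> k) = 1 / 2 \<and>
       Im (\<tau> k) = ((Re (\<tau> (k - 1)))\<^sup>2 + (Im (\<tau> (k - 1)))\<^sup>2 - Re (\<tau> (k - 1))) / (2 * Im (\<tau> (k - 1))) \<and>
       Im (\<tau> k) \<in> K \<and>
       (\<forall>M. deep_hole_lattice (Lat (\<tau> (k - 1))) M \<longleftrightarrow> M = Lat (\<tau> k))) \<and>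
    well_rounded (Lat (\<tau> n)) \<and>
    (\<exists>M. deep_hole_lattice (Lat (\<tau> n)) M) \<and>
    (\<forall>M. deep_hole_lattice (Lat (\<tau> n)) M \<longrightarrow> similar_lattices (Lat (\<tau> n)) M) \<and>
    (\<forall>k\<in>{1..<n}. \<tau> k \<in> fund_dom) \<and>
    cmod (\<tau> n) \<le> 1 \<and>
    int n \<le> \<lceil>log 2 (2 * Im \<tau>0 / sqrt 3)\<rceil>"
proof -
  define t where "t k = (next_parameter ^^ k) \<tau>0" for k
  have t0: "t 0 = \<tau>0" and tS: "t (Suc k) = next_parameter (t k)" for k by (simp_all add: t_def)
  define x where "x = log 2 (2 * Im \<tau>0 / sqrt 3)"
  \<comment> \<open>After \<open>N\<close> halvings the imaginary part is at most
    \<open>sqrt 3 / 2\<close>. Rounding up matters: for \<open>\<tau>0 = Complex 0 (11 / 10)\<close>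
    the logarithm lies strictly between 0 and 1, yet one step has to be taken.\<close>
  define N where "N = nat \<lceil>x\<rceil>"
  have im0: "sqrt 3 / 2 \<le> Im \<tau>0" using fund_dom_Im_ge[OF assms(2)] .
  then have q1: "1 \<le> 2 * Im \<tau>0 / sqrt 3" by (simp add: field_simps)
  then have "0 \<le> x" unfolding x_def by (subst zero_le_log_cancel_iff) linarith+
  then have N: "int N = \<lceil>x\<rceil>" "x \<le> real N" by (simp_all add: N_def)
  have fund: "t k \<in> fund_dom" if "\<And>j. j < k \<Longrightarrow> 1 < cmod (t j)" "1 < cmod (t k)" for k
    using that
  proof (induction k)
    case 0
    then show ?case using assms(2) t0 by simp
  next
    case (Suc k)
    then have "t k \<in> fund_dom" by simp
    then have "sqrt 3 / 6 \<le> Im (t (Suc k))" using next_parameter_Im_ge tS by simp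
    then have "0 \<le> Im (t (Suc k))" by (smt (verit) real_sqrt_ge_zero divide_nonneg_nonneg)
    moreover have "Re (t (Suc k)) = 1 / 2" by (simp add: tS next_parameter_def)
    ultimately show ?case using Suc.prems by (simp add: fund_dom_def)
  qed
  \<comment> \<open>Otherwise the parameters up to index \<open>N\<close> all lie in the domain, and
    the upper and lower bounds on \<open>Im (t N)\<close> meet. This leaves no room for modulus
    greater than 1.\<close>
  have small: "\<exists>k\<le>N. cmod (t k) \<le> 1"
  proof (rule ccontr)
    assume "\<not> ?thesis"
    then have big: "1 < cmod (t k)" if "k \<le> N" for k using that by force
    then have fd: "t k \<in> fund_dom" if "k \<le> N" for k using fund that by simp
    have dec: "Im (t k) \<le> Im \<tau>0 / 2 ^ k" if "k \<le> N" for k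
      using that
    proof (induction k)
      case 0
      then show ?case using t0 by simp
    next
      case (Suc k)
      then have "Im (t (Suc k)) \<le> Im (t k) / 2" using next_parameter_Im_le fd tS by simp
      also have "\<dots> \<le> Im \<tau>0 / 2 ^ k / 2" using Suc by simp
      finally show ?case by (simp add: mult.commute)
    qed
    have "2 * Im \<tau>0 / sqrt 3 = 2 powr x"
      unfolding x_def by (subst powr_log_cancel) (use q1 in \<open>linarith | simp\<close>)+
    also have "\<dots> \<le> 2 powr real N" using N by simp
    also have "\<dots> = 2 ^ N" by (simp add: powr_realpow)
    finally have "Im \<tau>0 / 2 ^ N \<le> sqrt 3 / 2" by (simp add: field_simps)
    then have le: "Im (t N) \<le> sqrt 3 / 2" using dec[of N] by linarith
    have ge: "sqrt 3 / 2 \<le> Im (t N)" using fund_dom_Im_ge fd by simp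
    show False
    \<comment> \<open>The real part equals 1/2 only after a step; for the initial parameter it is
      merely at most 1/2, which suffices.\<close>
    proof (cases N)
      case 0
      then have "Im \<tau>0 = sqrt 3 / 2" using le ge t0 by simp
      have "(Re \<tau>0)\<^sup>2 \<le> (1 / 2)\<^sup>2" using assms(2) by (intro power_mono) (auto simp: fund_dom_def)
      then have "cmod \<tau>0 \<le> 1" by (simp add: \<open>Im \<tau>0 = _\<close> cmod_def power_divide)
      then show False using big[of 0] t0 by simp
    next
      case (Suc k)
      then have re: "Re (t N) = 1 / 2" by (simp add: tS next_parameter_def)
      have im: "Im (t N) = sqrt 3 / 2" using le ge by simp
      have "cmod (t N) \<le> 1" unfolding cmod_def re im by (simp add: power_divide)
      then show False using big[of N] by simp
    qed
  qed
  \<comment> \<open>Stopping at the first parameter in the closed unit disk keeps all earlier ones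
    in the domain with modulus greater than 1, where the deep hole lattice is unique.\<close>
  define n where "n = (LEAST k. cmod (t k) \<le> 1)"
  have tn: "cmod (t n) \<le> 1" unfolding n_def using small by (meson LeastI)
  have nN: "n \<le> N" unfolding n_def using small by (meson Least_le order_trans)
  have big: "1 < cmod (t k)" if "k < n" for k using not_less_Least[of k] that unfolding n_def by force
  have fd: "t k \<in> fund_dom" if "k < n" for k using fund big that by simp
  have inK: "Re (t k) \<in> K \<and> Im (t k) \<in> K" for k
  proof (induction k)
    case 0
    then show ?case using assms t0 by simp
  next
    case (Suc k)
    have "inverse (1 + 1) \<in> K" using assms(1) unfolding real_subfield_def by blast
    then show ?case using Suc real_subfield_half_quotient[OF assms(1)]
      by (simp add: tS next_parameter_def inverse_eq_divide)
  qed
  have "(t n \<in> fund_dom \<and> cmod (t n) = 1) \<or> (Re (t n) = 1 / 2 \<and> sqrt 3 / 6 \<le> Im (t n) \<and> cmod (t n) \<le> 1)"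
  proof (cases n)
    case 0
    then show ?thesis using tn t0 assms(2) by (auto simp: fund_dom_def)
  next
    case (Suc k)
    then have "sqrt 3 / 6 \<le> Im (t n)" using next_parameter_Im_ge fd tS by simp
    moreover have "Re (t n) = 1 / 2" using Suc by (simp add: tS next_parameter_def)
    ultimately show ?thesis using tn by simp
  qed
  then obtain u v where uv: "lattice_basis (Lat (t n)) u v" "reduced_pair u v" "norm u = norm v"
    by (rule Lat_equal_norm_basis)
  have steps: "Re (t k) = 1 / 2 \<and>
       Im (t k) = ((Re (t (k - 1)))\<^sup>2 + (Im (t (k - 1)))\<^sup>2 - Re (t (k - 1))) / (2 * Im (t (k - 1))) \<and>
       Im (t k) \<in> K \<and> (\<forall>M. deep_hole_lattice (Lat (t (k - 1))) M \<longleftrightarrow> M = Lat (t k))"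
    if k: "k \<in> {1..n}" for k
  proof -
    obtain j where j: "k = Suc j" "j < n" using k by (cases k) auto
    then show ?thesis using deep_hole_lattice_Lat[OF fd big] inK[of k]
      by (simp add: j tS) (simp add: next_parameter_def)
  qed
  have log: "int n \<le> \<lceil>log 2 (2 * Im \<tau>0 / sqrt 3)\<rceil>" using nN N(1) unfolding x_def by linarith
  have sim: "\<forall>M. deep_hole_lattice (Lat (t n)) M \<longrightarrow> similar_lattices (Lat (t n)) M"
    using deep_hole_lattice_of_equal_norm_basis(3)[OF uv] by blast
  have fds: "\<forall>k\<in>{1..<n}. t k \<in> fund_dom" using fd by simp
  show ?thesis
    by (rule exI[of _ n], rule exI[of _ t])
      (intro conjI t0 ballI[OF steps] deep_hole_lattice_of_equal_norm_basis(1,2)[OF uv] sim fds tn log)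
qed

end
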